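(* Let $s\ge1$ be an integer, let $0=c_0<c_1<\cdots<c_s=1$, and let $a_{ij},\widehat a_{ij}\in\mathbb R$ ($1\le i\le s$, $0\le j\le s$) satisfy the Hermite moment conditions $$\sum_{j=0}^s a_{ij}c_j^{m-1}+(m-1)\sum_{j=0}^s\widehat a_{ij}c_j^{m-2}=\frac{c_i^m}{m},\qquad m=1,\ldots,2s,\quad i=1,\ldots,s$$ (for $m=1$ the second sum is zero). Consider the method which, from $Y_0=u^n$, determines $Y_1,\ldots,Y_s$ by the stage system $$Y_i=Y_0+\Delta t\sum_{j=0}^s a_{ij}\mathcal L(Y_j)+\Delta t^2\sum_{j=0}^s\widehat a_{ij}\dot{\mathcal L}(Y_j),\qquad i=1,\ldots,s,$$ and sets $u^{n+1}=Y_s$. Assume that $\mathcal L$ and $\dot{\mathcal L}$ are sufficiently smooth in a neighborhood of the exact solution $u$ of $u_t=\mathcal L(u)$ and that $u$ has $2s+1$ bounded time derivatives on $[0,T]$. Then for all sufficiently small $\Delta t$ the stage system has a locally unique solution branch satisfying $Y_i\to u^n$ as $\Delta t\to0$ ($i=1,\ldots,s$). With the method defined by this branch, a step started from exact data $u^n=u(t_n)$ satisfies $$u^{n+1}-u(t_{n+1})=\mathcal O(\Delta t^{2s+1}),$$ and, for exact initial data $u^0=u(0)$, $$\max_{0\le n\le T/\Delta t}\|u^n-u(t_n)\|=\mathcal O(\Delta t^{2s}).$$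
   Context: The initial-value problem is the autonomous system $u_t=\mathcal L(u)$, $u(t)\in\mathbb R^d$, on $[0,T]$ with initial time $t_0=0$; $\dot{\mathcal L}(u)=\mathcal L_u(u)\mathcal L(u)$ is the first total time derivative of the vector field. The time grid is uniform: $t_n=n\,\Delta t$, $t_{n+1}=t_n+\Delta t$. "Sufficiently smooth" means of class $C^k$ for $k$ large enough. The $\mathcal O$ constants are independent of $\Delta t$ and of $n$ (for $\Delta t$ sufficiently small and $t_{n+1}\le T$). The convention $0^0=1$ is used for powers of $c_0=0$. *)

theory Defs
  imports "HOL-Analysis.Analysis"
begin

text \<open>Class \<open>C\<^sup>k\<close> on an open set \<open>U\<close>, by way of iterated directional derivatives; in finite
  dimension continuity of all of these is the same as continuity of the Frechet derivatives in
  operator norm.\<close>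

primrec Ck_on :: "nat \<Rightarrow> ('a::euclidean_space \<Rightarrow> 'b::real_normed_vector) \<Rightarrow> 'a set \<Rightarrow> bool" where
  "Ck_on 0 f U \<longleftrightarrow> continuous_on U f"
| "Ck_on (Suc k) f U \<longleftrightarrow>
     (\<forall>x\<in>U. f differentiable (at x)) \<and> (\<forall>v. Ck_on k (\<lambda>x. frechet_derivative f (at x) v) U)"

definition total_deriv :: "('a::euclidean_space \<Rightarrow> 'a) \<Rightarrow> 'a \<Rightarrow> 'a" where
  "total_deriv L x = frechet_derivative L (at x) (L x)"

text \<open>The derivatives are one-sided at the end points of the interval, and the derivative of
  order \<open>m\<close> need not be continuous.\<close>

definition has_bounded_derivs :: "nat \<Rightarrow> (real \<Rightarrow> 'a::real_normed_vector) \<Rightarrow> real \<Rightarrow> bool" where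
  "has_bounded_derivs m u T \<longleftrightarrow>
     (\<exists>D. D 0 = u \<and>
        (\<forall>j<m. \<forall>t\<in>{0..T}. (D j has_vector_derivative D (Suc j) t) (at t within {0..T})) \<and>
        (\<forall>j\<le>m. bounded (D j ` {0..T})))"

definition solves_on :: "('a::real_normed_vector \<Rightarrow> 'a) \<Rightarrow> (real \<Rightarrow> 'a) \<Rightarrow> real \<Rightarrow> bool" where
  "solves_on L u T \<longleftrightarrow>
     (\<forall>t\<in>{0..T}. (u has_vector_derivative L (u t)) (at t within {0..T}))"

text \<open>For \<open>m = 1\<close> the truncated exponent \<open>m - 2\<close> is harmless, as the second sum has factor 0.\<close>

definition hermite_moments ::
    "nat \<Rightarrow> (nat \<Rightarrow> real) \<Rightarrow> (nat \<Rightarrow> nat \<Rightarrow> real) \<Rightarrow> (nat \<Rightarrow> nat \<Rightarrow> real) \<Rightarrow> bool" where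
  "hermite_moments s c a a' \<longleftrightarrow>
     (\<forall>m\<in>{1..2 * s}. \<forall>i\<in>{1..s}.
        (\<Sum>j=0..s. a i j * c j ^ (m - 1)) + real (m - 1) * (\<Sum>j=0..s. a' i j * c j ^ (m - 2))
          = c i ^ m / real m)"

definition stage_system ::
    "nat \<Rightarrow> (nat \<Rightarrow> nat \<Rightarrow> real) \<Rightarrow> (nat \<Rightarrow> nat \<Rightarrow> real) \<Rightarrow> ('a::euclidean_space \<Rightarrow> 'a)
      \<Rightarrow> real \<Rightarrow> (nat \<Rightarrow> 'a) \<Rightarrow> bool" where
  "stage_system s a a' L h Y \<longleftrightarrow>
     (\<forall>i\<in>{1..s}. Y i = Y 0 + h *\<^sub>R (\<Sum>j=0..s. a i j *\<^sub>R L (Y j))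
                          + h\<^sup>2 *\<^sub>R (\<Sum>j=0..s. a' i j *\<^sub>R total_deriv L (Y j)))"

text \<open>\<open>Y h y i\<close> is the \<open>i\<close>-th stage for step size \<open>h\<close> and initial value \<open>y\<close>. The bound \<open>h0\<close> on the
  step size and the radius \<open>r\<close> of uniqueness are the same for all initial values \<open>y \<in> V\<close>, and the
  stages stay where \<open>L\<close> is smooth. Entries \<open>Y h y i\<close> with \<open>i > s\<close> are irrelevant.\<close>

definition locally_unique_branch ::
    "nat \<Rightarrow> (nat \<Rightarrow> nat \<Rightarrow> real) \<Rightarrow> (nat \<Rightarrow> nat \<Rightarrow> real) \<Rightarrow> ('a::euclidean_space \<Rightarrow> 'a)
      \<Rightarrow> 'a set \<Rightarrow> 'a set \<Rightarrow> real \<Rightarrow> real \<Rightarrow> (real \<Rightarrow> 'a \<Rightarrow> nat \<Rightarrow> 'a) \<Rightarrow> bool" where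
  "locally_unique_branch s a a' L U V r h0 Y \<longleftrightarrow>
     (\<forall>y\<in>V. ball y r \<subseteq> U) \<and>
     (\<forall>y\<in>V. \<forall>h\<in>{0<..h0}.
        Y h y 0 = y \<and> (\<forall>i\<in>{1..s}. Y h y i \<in> ball y r) \<and> stage_system s a a' L h (Y h y) \<and>
        (\<forall>Z. Z 0 = y \<and> (\<forall>i\<in>{1..s}. Z i \<in> ball y r) \<and> stage_system s a a' L h Z
             \<longrightarrow> (\<forall>i\<in>{1..s}. Z i = Y h y i))) \<and>
     (\<forall>i\<in>{1..s}. \<forall>y\<in>V. continuous_on {0<..h0} (\<lambda>h. Y h y i)) \<and>
     (\<forall>i\<in>{1..s}. uniform_limit V (\<lambda>h y. Y h y i) (\<lambda>y. y) (at_right 0))"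

definition num_sol :: "nat \<Rightarrow> (real \<Rightarrow> 'a \<Rightarrow> nat \<Rightarrow> 'a) \<Rightarrow> real \<Rightarrow> 'a \<Rightarrow> nat \<Rightarrow> 'a" where
  "num_sol s Y h y n = ((\<lambda>v. Y h v s) ^^ n) y"

end

theory Submission
  imports Defs
begin

text \<open>The stages are the fixed point of a map that is Lipschitz with constant \<open>O(h)\<close>, so that Picard
  iteration converges for small \<open>h\<close>, and two families of stages that satisfy the stage system up to
  residuals \<open>\<epsilon>\<close> differ by at most \<open>(1 + C h) \<delta> + 2 \<epsilon>\<close>, where \<open>\<delta>\<close> is the difference of
  the initial values. This one estimate gives uniqueness, continuity in \<open>h\<close>, stability of a step
  and, applied to the exact values \<open>u (t + c\<^sub>j h)\<close>, the local error: by the moment conditions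
  those have residual \<open>O(h\<^sup>2\<^sup>s\<^sup>+\<^sup>1)\<close>. Gronwall's inequality then bounds the global error.\<close>

section \<open>Stability and solvability of the stage equations\<close>

text \<open>The fields \<open>F\<close> and \<open>G\<close> are independent parameters, so that the
  estimates rest on Lipschitz and size bounds alone. With \<open>Z 0\<close> left out, the residual
  of any family is \<open>Z i - Z 0 - stage_map s a a' F G h Z i\<close>.\<close>

definition stage_map ::
    "nat \<Rightarrow> (nat \<Rightarrow> nat \<Rightarrow> real) \<Rightarrow> (nat \<Rightarrow> nat \<Rightarrow> real) \<Rightarrow> ('a \<Rightarrow> 'a) \<Rightarrow> ('a \<Rightarrow> 'a)
      \<Rightarrow> real \<Rightarrow> (nat \<Rightarrow> 'a) \<Rightarrow> nat \<Rightarrow> 'a::real_normed_vector" where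
  "stage_map s a a' F G h Z i =
     h *\<^sub>R (\<Sum>j=0..s. a i j *\<^sub>R F (Z j)) + h\<^sup>2 *\<^sub>R (\<Sum>j=0..s. a' i j *\<^sub>R G (Z j))"

lemma stage_system_iff:
  "stage_system s a a' L h Z \<longleftrightarrow>
     (\<forall>i\<in>{1..s}. Z i = Z 0 + stage_map s a a' L (total_deriv L) h Z i)"
  by (simp add: stage_system_def stage_map_def add.assoc)

text \<open>For h <= 1 the quadratic term is absorbed into the linear one, so a single bound
  \<open>A\<close> serves both coefficient rows. The weights \<open>e j\<close> become stage
  differences in Lipschitz estimates and constants in size estimates.\<close>

lemma norm_stage_sum_le:
  fixes f g :: "nat \<Rightarrow> 'a::real_normed_vector"
  assumes h: "0 \<le> h" "h \<le> 1" and A: "\<And>j. j \<le> s \<Longrightarrow> \<bar>b j\<bar> + \<bar>b' j\<bar> \<le> A"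
    and f: "\<And>j. j \<le> s \<Longrightarrow> norm (f j) \<le> e j" and g: "\<And>j. j \<le> s \<Longrightarrow> norm (g j) \<le> e j"
  shows "norm (h *\<^sub>R (\<Sum>j=0..s. b j *\<^sub>R f j) + h\<^sup>2 *\<^sub>R (\<Sum>j=0..s. b' j *\<^sub>R g j))
           \<le> h * A * (\<Sum>j=0..s. e j)"
proof -
  have "h\<^sup>2 \<le> h"
    using h by (simp add: power2_eq_square mult_left_le)
  have "norm (h *\<^sub>R (\<Sum>j=0..s. b j *\<^sub>R f j) + h\<^sup>2 *\<^sub>R (\<Sum>j=0..s. b' j *\<^sub>R g j))
      \<le> h * norm (\<Sum>j=0..s. b j *\<^sub>R f j) + h\<^sup>2 * norm (\<Sum>j=0..s. b' j *\<^sub>R g j)"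
    using h by (intro norm_triangle_le) simp
  also have "\<dots> \<le> h * (\<Sum>j=0..s. \<bar>b j\<bar> * e j) + h * (\<Sum>j=0..s. \<bar>b' j\<bar> * e j)"
  proof -
    have "norm (\<Sum>j=0..s. b j *\<^sub>R f j) \<le> (\<Sum>j=0..s. \<bar>b j\<bar> * e j)"
      by (intro sum_norm_le) (simp add: f mult_left_mono)
    moreover have "norm (\<Sum>j=0..s. b' j *\<^sub>R g j) \<le> (\<Sum>j=0..s. \<bar>b' j\<bar> * e j)"
      by (intro sum_norm_le) (simp add: g mult_left_mono)
    ultimately show ?thesis
      using h \<open>h\<^sup>2 \<le> h\<close> by (intro add_mono mult_mono) auto
  qed
  also have "\<dots> = h * (\<Sum>j=0..s. (\<bar>b j\<bar> + \<bar>b' j\<bar>) * e j)"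
    by (simp add: sum.distrib distrib_left distrib_right)
  also have "\<dots> \<le> h * (\<Sum>j=0..s. A * e j)"
    using h A f by (intro mult_left_mono sum_mono mult_right_mono) (auto intro: order_trans[OF norm_ge_zero])
  finally show ?thesis
    by (simp add: sum_distrib_left mult.assoc)
qed

lemma stage_map_lipschitz:
  assumes h: "0 \<le> h" "h \<le> 1" and A: "\<And>j. j \<le> s \<Longrightarrow> \<bar>a i j\<bar> + \<bar>a' i j\<bar> \<le> A"
    and F: "\<And>x y. x \<in> W \<Longrightarrow> y \<in> W \<Longrightarrow> norm (F x - F y) \<le> M * norm (x - y)"
    and G: "\<And>x y. x \<in> W \<Longrightarrow> y \<in> W \<Longrightarrow> norm (G x - G y) \<le> M * norm (x - y)"
    and Z: "\<And>j. j \<le> s \<Longrightarrow> Z j \<in> W" and Z': "\<And>j. j \<le> s \<Longrightarrow> Z' j \<in> W"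
  shows "norm (stage_map s a a' F G h Z i - stage_map s a a' F G h Z' i)
           \<le> h * A * M * (\<Sum>j=0..s. norm (Z j - Z' j))"
proof -
  have "stage_map s a a' F G h Z i - stage_map s a a' F G h Z' i =
      h *\<^sub>R (\<Sum>j=0..s. a i j *\<^sub>R (F (Z j) - F (Z' j))) + h\<^sup>2 *\<^sub>R (\<Sum>j=0..s. a' i j *\<^sub>R (G (Z j) - G (Z' j)))"
    by (simp add: stage_map_def sum_subtractf algebra_simps)
  also have "norm \<dots> \<le> h * A * (\<Sum>j=0..s. M * norm (Z j - Z' j))"
    using assms by (intro norm_stage_sum_le) auto
  finally show ?thesis
    by (simp add: sum_distrib_left mult.assoc)
qed

text \<open>Differences of the unknown stages occur on both sides and are absorbed by
  \<open>small\<close>. The factor of the initial difference must be 1 + O(h), not merely bounded,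
  because it is raised to the number of steps in the global estimate.\<close>

lemma stage_stability:
  assumes h: "0 \<le> h" "h \<le> 1" and M: "0 \<le> M" and A0: "0 \<le> A"
    and A: "\<And>i j. i \<in> {1..s} \<Longrightarrow> j \<le> s \<Longrightarrow> \<bar>a i j\<bar> + \<bar>a' i j\<bar> \<le> A"
    and F: "\<And>x y. x \<in> W \<Longrightarrow> y \<in> W \<Longrightarrow> norm (F x - F y) \<le> M * norm (x - y)"
    and G: "\<And>x y. x \<in> W \<Longrightarrow> y \<in> W \<Longrightarrow> norm (G x - G y) \<le> M * norm (x - y)"
    and small: "2 * (real s * (h * A * M)) \<le> 1"
    and Z: "\<And>j. j \<le> s \<Longrightarrow> Z j \<in> W" and Z': "\<And>j. j \<le> s \<Longrightarrow> Z' j \<in> W"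
    and eps: "\<And>i. i \<in> {1..s} \<Longrightarrow>
      norm ((Z i - Z 0 - stage_map s a a' F G h Z i) - (Z' i - Z' 0 - stage_map s a a' F G h Z' i)) \<le> \<epsilon>"
    and i: "i \<in> {1..s}"
  shows "norm (Z i - Z' i) \<le> (1 + 2 * (real s + 1) * (A * M) * h) * norm (Z 0 - Z' 0) + 2 * \<epsilon>"
proof -
  define \<delta> where "\<delta> = norm (Z 0 - Z' 0)"
  define S where "S = (\<Sum>j=1..s. norm (Z j - Z' j))"
  define q where "q = h * A * M"
  have q: "0 \<le> q" "2 * (real s * q) \<le> 1"
    using h M A0 small by (auto simp: q_def)
  have sum0: "(\<Sum>j=0..s. norm (Z j - Z' j)) = \<delta> + S"
    by (simp add: sum.atLeast_Suc_atMost \<delta>_def S_def)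
  have le: "norm (Z i - Z' i) \<le> \<delta> + q * (\<delta> + S) + \<epsilon>" if i: "i \<in> {1..s}" for i
  proof -
    let ?m = "stage_map s a a' F G h"
    have eq: "Z i - Z' i = (Z 0 - Z' 0) + (?m Z i - ?m Z' i)
        + ((Z i - Z 0 - ?m Z i) - (Z' i - Z' 0 - ?m Z' i))"
      by simp
    have "norm (?m Z i - ?m Z' i) \<le> q * (\<delta> + S)"
      unfolding q_def sum0[symmetric] using A[OF i] F G Z Z' by (intro stage_map_lipschitz[where W = W] h) blast+
    then show ?thesis
      unfolding \<delta>_def using eps[OF i] by (subst eq) (intro norm_triangle_mono order_refl)
  qed
  have "S \<le> (\<Sum>j=1..s. \<delta> + q * (\<delta> + S) + \<epsilon>)"
    unfolding S_def by (rule sum_mono) (use le in \<open>auto simp: S_def\<close>)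
  also have "\<dots> = real s * \<delta> + (real s * q) * (\<delta> + S) + real s * \<epsilon>"
    by (simp add: algebra_simps)
  \<comment> \<open>Now \<open>S\<close> has the coefficient 1/2 and can be moved to the left-hand
    side.\<close>
  also have "\<dots> \<le> real s * \<delta> + 1/2 * (\<delta> + S) + real s * \<epsilon>"
    using q by (intro add_mono mult_right_mono order_refl) (auto simp: \<delta>_def S_def sum_nonneg)
  finally have S: "S \<le> (2 * real s + 1) * \<delta> + 2 * real s * \<epsilon>"
    by (simp add: field_simps)
  have "0 \<le> \<epsilon>"
    using eps[OF i] norm_ge_zero order_trans by blast
  \<comment> \<open>The bound on \<open>S\<close> has the factor 2 s + 1 in front of
    \<open>\<delta>\<close>. Inserted into the estimate of a single stage it is multiplied by
    \<open>q\<close>, which is O(h), so the factor becomes 1 + O(h).\<close>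
  have "norm (Z i - Z' i) \<le> \<delta> + q * (\<delta> + ((2 * real s + 1) * \<delta> + 2 * real s * \<epsilon>)) + \<epsilon>"
    using le[OF i] S q mult_left_mono[of "\<delta> + S" "\<delta> + ((2 * real s + 1) * \<delta> + 2 * real s * \<epsilon>)" q] by linarith
  also have "\<dots> = (1 + 2 * (real s + 1) * q) * \<delta> + (2 * (real s * q)) * \<epsilon> + \<epsilon>"
    by (simp add: algebra_simps)
  also have "\<dots> \<le> (1 + 2 * (real s + 1) * q) * \<delta> + 1 * \<epsilon> + \<epsilon>"
    using q \<open>0 \<le> \<epsilon>\<close> by (intro add_mono mult_right_mono) (auto simp: \<delta>_def)
  finally show ?thesis
    by (simp add: q_def \<delta>_def mult_ac)
qed

text \<open>Picard iteration from the constant family \<open>y\<close>: the second part of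
  \<open>small\<close> keeps the iterates in the closed ball, the first halves the summed increments
  in each step.\<close>

lemma stage_exists:
  fixes F G :: "'a::banach \<Rightarrow> 'a"
  assumes h: "0 \<le> h" "h \<le> 1" and \<rho>: "0 \<le> \<rho>"
    and A: "\<And>i j. i \<in> {1..s} \<Longrightarrow> j \<le> s \<Longrightarrow> \<bar>a i j\<bar> + \<bar>a' i j\<bar> \<le> A"
    and F: "\<And>x x'. x \<in> cball y \<rho> \<Longrightarrow> x' \<in> cball y \<rho> \<Longrightarrow> norm (F x - F x') \<le> M * norm (x - x')"
    and G: "\<And>x x'. x \<in> cball y \<rho> \<Longrightarrow> x' \<in> cball y \<rho> \<Longrightarrow> norm (G x - G x') \<le> M * norm (x - x')"
    and FB: "\<And>x. x \<in> cball y \<rho> \<Longrightarrow> norm (F x) \<le> B"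
    and GB: "\<And>x. x \<in> cball y \<rho> \<Longrightarrow> norm (G x) \<le> B"
    and small: "2 * (real s * (h * A * M)) \<le> 1" "h * A * ((real s + 1) * B) \<le> \<rho>"
  shows "\<exists>Z. Z 0 = y \<and> (\<forall>i\<in>{1..s}. Z i \<in> cball y \<rho> \<and> Z i = y + stage_map s a a' F G h Z i)"
proof -
  \<comment> \<open>Indices outside \<open>{1..s}\<close> are pinned to \<open>y\<close>; this fixes
    the initial value at index 0 and makes every component converge.\<close>
  define \<Phi> where "\<Phi> Z i = (if i \<in> {1..s} then y + stage_map s a a' F G h Z i else y)" for Z i
  define W where "W k = (\<Phi> ^^ k) (\<lambda>_. y)" for k
  have W_Suc: "W (Suc k) = \<Phi> (W k)" for k
    by (simp add: W_def)
  have W_cball: "W k i \<in> cball y \<rho>" for k i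
  proof (induction k arbitrary: i)
    case 0
    then show ?case using \<rho> by (simp add: W_def)
  next
    case (Suc k)
    have "norm (stage_map s a a' F G h (W k) i) \<le> \<rho>" if i: "i \<in> {1..s}"
    proof -
      have "norm (stage_map s a a' F G h (W k) i) \<le> h * A * (\<Sum>j=0..s. B)"
        unfolding stage_map_def using h A[OF i] FB GB Suc by (intro norm_stage_sum_le) blast+
      then show ?thesis using small by (simp add: algebra_simps)
    qed
    then show ?case
      using \<rho> by (auto simp: W_Suc \<Phi>_def dist_norm)
  qed
  define d where "d k = (\<Sum>j=0..s. norm (W (Suc k) j - W k j))" for k
  have d_Suc: "d (Suc k) \<le> d k / 2" for k
  proof -
    \<comment> \<open>The increment at index 0 vanishes, so only the \<open>s\<close> genuine stages
      are counted.\<close>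
    have "d (Suc k) = (\<Sum>j=1..s. norm (W (Suc (Suc k)) j - W (Suc k) j))"
      unfolding d_def by (simp add: sum.atLeast_Suc_atMost W_Suc \<Phi>_def)
    also have "\<dots> \<le> (\<Sum>j=1..s. h * A * M * d k)"
    proof (rule sum_mono)
      fix i assume i: "i \<in> {1..s}"
      have "norm (stage_map s a a' F G h (W (Suc k)) i - stage_map s a a' F G h (W k) i)
          \<le> h * A * M * (\<Sum>j=0..s. norm (W (Suc k) j - W k j))"
        using A[OF i] F G W_cball by (intro stage_map_lipschitz[where W = "cball y \<rho>"] h) blast+
      then show "norm (W (Suc (Suc k)) i - W (Suc k) i) \<le> h * A * M * d k"
        using i by (simp add: W_Suc[of "Suc k"] W_Suc[of k] \<Phi>_def d_def)
    qed
    also have "\<dots> = (real s * (h * A * M)) * d k"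
      by simp
    also have "\<dots> \<le> 1/2 * d k"
      using small by (intro mult_right_mono) (auto simp: d_def sum_nonneg)
    finally show ?thesis by simp
  qed
  have d: "d k \<le> d 0 * (1/2) ^ k" for k
  proof (induction k)
    case (Suc k)
    then show ?case using d_Suc[of k] by simp
  qed simp
  have "convergent (\<lambda>k. W k j)" for j
  proof -
    have "norm (W (Suc k) j - W k j) \<le> d 0 * (1/2) ^ k" for k
    proof (cases "j \<in> {1..s}")
      case True
      then have "norm (W (Suc k) j - W k j) \<le> d k"
        unfolding d_def by (intro member_le_sum) auto
      then show ?thesis using d[of k] by linarith
    next
      case False
      then have "W k j = y" for k
        by (cases k) (simp add: W_def, auto simp: W_Suc \<Phi>_def)
      then show ?thesis by (simp add: d_def sum_nonneg)
    qed
    \<comment> \<open>The increments are dominated by a geometric series, and their partial sums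
      telescope to the iterates up to the constant \<open>W 0 j\<close>.\<close>
    then have "summable (\<lambda>k. W (Suc k) j - W k j)"
      by (intro summable_comparison_test'[OF summable_mult[OF summable_geometric]]) auto
    then show ?thesis
      unfolding summable_iff_convergent sum_lessThan_telescope[of "\<lambda>k. W k j"] convergent_diff_const_right_iff .
  qed
  then obtain Z where Z: "\<And>j. (\<lambda>k. W k j) \<longlonglongrightarrow> Z j"
    unfolding convergent_def by metis
  have Z_cball: "Z j \<in> cball y \<rho>" for j
    using closed_sequentially[OF closed_cball _ Z] W_cball by blast
  have cont: "continuous_on (cball y \<rho>) F" "continuous_on (cball y \<rho>) G"
  proof -
    \<comment> \<open>The absolute value supplies the nonnegative constant that
      \<open>lipschitz_on\<close> requires.\<close>
    have "\<bar>M\<bar>-lipschitz_on (cball y \<rho>) F" "\<bar>M\<bar>-lipschitz_on (cball y \<rho>) G"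
      using F G by (auto intro!: lipschitz_onI simp: dist_norm intro: order_trans[OF _ mult_right_mono[OF abs_ge_self]])
    then show "continuous_on (cball y \<rho>) F" "continuous_on (cball y \<rho>) G"
      by (auto intro: lipschitz_on_continuous_on)
  qed
  have FZ: "(\<lambda>k. F (W k j)) \<longlonglongrightarrow> F (Z j)" "(\<lambda>k. G (W k j)) \<longlonglongrightarrow> G (Z j)" for j
    using cont[THEN continuous_on_tendsto_compose, OF Z Z_cball] W_cball by auto
  have "Z 0 = y"
  proof -
    have "W k 0 = y" for k
      by (cases k) (simp add: W_def, simp add: W_Suc \<Phi>_def)
    then show ?thesis using Z[of 0] by (simp add: LIMSEQ_const_iff)
  qed
  moreover have "Z i = y + stage_map s a a' F G h Z i" if i: "i \<in> {1..s}" for i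
  proof -
    have "(\<lambda>k. y + stage_map s a a' F G h (W k) i) \<longlonglongrightarrow> y + stage_map s a a' F G h Z i"
      unfolding stage_map_def by (intro tendsto_intros FZ)
    moreover have "(\<lambda>k. W (Suc k) i) = (\<lambda>k. y + stage_map s a a' F G h (W k) i)"
      using i by (simp add: W_Suc \<Phi>_def)
    ultimately show ?thesis
      using LIMSEQ_unique LIMSEQ_Suc[OF Z[of i]] by metis
  qed
  ultimately show ?thesis using Z_cball by blast
qed

section \<open>Taylor expansion and the residual of the exact solution\<close>

text \<open>The integral remainder is a gauge integral whose existence comes with Taylor's formula,
  so a bounded but discontinuous top derivative \<open>D p\<close> is covered. The factor 1/p! of
  the sharp bound is discarded.\<close>

lemma Taylor_bound:
  fixes D :: "nat \<Rightarrow> real \<Rightarrow> 'a::banach"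
  assumes "p > 0" "a \<le> b"
    and D: "\<And>m t. m < p \<Longrightarrow> t \<in> {a..b} \<Longrightarrow> (D m has_vector_derivative D (Suc m) t) (at t within {a..b})"
    and B: "\<And>t. t \<in> {a..b} \<Longrightarrow> norm (D p t) \<le> B"
  shows "norm (D 0 b - (\<Sum>m<p. ((b - a) ^ m / fact m) *\<^sub>R D m a)) \<le> B * (b - a) ^ p"
proof -
  have "0 \<le> B"
    by (rule order_trans[OF norm_ge_zero B[of a]]) (use \<open>a \<le> b\<close> in simp)
  have int: "((\<lambda>x. ((b - x) ^ (p - 1) / fact (p - 1)) *\<^sub>R D p x) has_integral
      D 0 b - (\<Sum>m<p. ((b - a) ^ m / fact m) *\<^sub>R D m a)) (cbox a b)"
    using Taylor_has_integral[of p D "D 0" a b] assms by simp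
  have "norm (((b - x) ^ (p - 1) / fact (p - 1)) *\<^sub>R D p x) \<le> (b - a) ^ (p - 1) * B"
    if x: "x \<in> cbox a b" for x
  proof -
    have "(b - x) ^ (p - 1) / fact (p - 1) \<le> (b - x) ^ (p - 1) / 1"
      using x by (intro divide_left_mono) (auto simp: fact_ge_1)
    also have "\<dots> \<le> (b - a) ^ (p - 1)"
      using x by (auto intro: power_mono)
    finally have "(b - x) ^ (p - 1) / fact (p - 1) * norm (D p x) \<le> (b - a) ^ (p - 1) * B"
      using x B \<open>a \<le> b\<close> by (intro mult_mono) auto
    then show ?thesis
      using x by simp
  qed
  from has_integral_bound[OF _ int this] have
    "norm (D 0 b - (\<Sum>m<p. ((b - a) ^ m / fact m) *\<^sub>R D m a)) \<le> (b - a) ^ (p - 1) * B * (b - a)"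
    using \<open>a \<le> b\<close> \<open>0 \<le> B\<close> by simp
  also have "\<dots> = B * (b - a) ^ p"
    using \<open>p > 0\<close> by (cases p) auto
  finally show ?thesis .
qed

text \<open>The coefficients of the Taylor polynomials in the residual cancel by the moment conditions,
  so that only the remainders of \<open>u\<close>, \<open>u'\<close> and \<open>u''\<close>, of orders \<open>2 s + 1\<close>, \<open>2 s\<close> and
  \<open>2 s - 1\<close>, are left.\<close>

lemma hermite_residual_bound:
  fixes D :: "nat \<Rightarrow> real \<Rightarrow> 'a::banach"
  assumes s: "s \<ge> 1" and moments: "hermite_moments s c a a'"
    and c: "\<And>j. j \<le> s \<Longrightarrow> 0 \<le> c j \<and> c j \<le> 1"
    and A: "\<And>j. j \<le> s \<Longrightarrow> \<bar>a i j\<bar> + \<bar>a' i j\<bar> \<le> A" and i: "i \<in> {1..s}"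
    and D: "\<And>m x. m < 2 * s + 1 \<Longrightarrow> x \<in> {0..T} \<Longrightarrow>
      (D m has_vector_derivative D (Suc m) x) (at x within {0..T})"
    and B: "\<And>m x. m \<le> 2 * s + 1 \<Longrightarrow> x \<in> {0..T} \<Longrightarrow> norm (D m x) \<le> B"
    and t: "0 \<le> t" "0 \<le> h" "t + h \<le> T"
  shows "norm (D 0 (t + c i * h) - D 0 t - (h *\<^sub>R (\<Sum>j=0..s. a i j *\<^sub>R D 1 (t + c j * h))
      + h\<^sup>2 *\<^sub>R (\<Sum>j=0..s. a' i j *\<^sub>R D 2 (t + c j * h)))) \<le> (1 + (real s + 1) * A) * B * h ^ (2 * s + 1)"
proof -
  \<comment> \<open>\<open>P l j\<close> is the Taylor polynomial of degree 2 s - l of the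
    derivative of order \<open>l\<close>; for all \<open>l\<close> it stops at the derivative of
    \<open>u\<close> of order 2 s.\<close>
  define P where "P l j = (\<Sum>m<2 * s + 1 - l. ((c j * h) ^ m / fact m) *\<^sub>R D (l + m) t)" for l j
  define R where "R l j = D l (t + c j * h) - P l j" for l j
  have "0 \<le> B"
    by (rule order_trans[OF norm_ge_zero B[of 0 t]]) (use t in auto)
  have R: "norm (R l j) \<le> B * h ^ (2 * s + 1 - l)" if "l \<le> 2" "j \<le> s" for l j
  proof -
    have ch: "0 \<le> c j * h" "c j * h \<le> h"
      using c[OF \<open>j \<le> s\<close>] t by (auto simp: mult_left_le_one_le)
    have sub: "{t..t + c j * h} \<subseteq> {0..T}"
      using t ch by auto
    have "norm (R l j) \<le> B * (c j * h) ^ (2 * s + 1 - l)"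
      using Taylor_bound[of "2 * s + 1 - l" t "t + c j * h" "\<lambda>m. D (l + m)" B]
        s that sub ch D[THEN has_vector_derivative_within_subset, OF _ _ sub] B
      by (fastforce simp: R_def P_def)
    also have "\<dots> \<le> B * h ^ (2 * s + 1 - l)"
      using ch \<open>0 \<le> B\<close> by (intro mult_left_mono power_mono)
    finally show ?thesis .
  qed
  have Sum0: "P 0 i = D 0 t + (\<Sum>m=1..2 * s. ((c i * h) ^ m / fact m) *\<^sub>R D m t)"
    unfolding P_def by (simp add: lessThan_Suc_atMost atMost_atLeast0 sum.atLeast_Suc_atMost)
  have Sum1: "h *\<^sub>R (\<Sum>j=0..s. a i j *\<^sub>R P 1 j)
      = (\<Sum>m=1..2 * s. (h ^ m / fact (m - 1) * (\<Sum>j=0..s. a i j * c j ^ (m - 1))) *\<^sub>R D m t)"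
  proof -
    have "h *\<^sub>R (\<Sum>j=0..s. a i j *\<^sub>R P 1 j)
        = (\<Sum>m<2 * s. (h ^ Suc m / fact m * (\<Sum>j=0..s. a i j * c j ^ m)) *\<^sub>R D (Suc m) t)"
      unfolding P_def scaleR_sum_right sum_distrib_left scaleR_sum_left
      by (subst sum.swap) (auto intro!: sum.cong simp: power_mult_distrib)
    then show ?thesis
      by (simp add: sum.shift_bounds_cl_Suc_ivl[symmetric] sum.atLeast1_atMost_eq)
  qed
  have Sum2: "h\<^sup>2 *\<^sub>R (\<Sum>j=0..s. a' i j *\<^sub>R P 2 j)
      = (\<Sum>m=1..2 * s. (h ^ m / fact (m - 1) * (real (m - 1) * (\<Sum>j=0..s. a' i j * c j ^ (m - 2)))) *\<^sub>R D m t)"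
  proof -
    have "h\<^sup>2 *\<^sub>R (\<Sum>j=0..s. a' i j *\<^sub>R P 2 j)
        = (\<Sum>m<2 * s - 1. (h ^ (m + 2) / fact m * (\<Sum>j=0..s. a' i j * c j ^ m)) *\<^sub>R D (m + 2) t)"
      unfolding P_def scaleR_sum_right sum_distrib_left scaleR_sum_left
      by (subst sum.swap) (auto intro!: sum.cong simp: power_mult_distrib power2_eq_square)
    \<comment> \<open>Writing 1/m! as (m + 1)/(m + 1)! produces the factor m - 1 of the moment
      conditions, up to the index shift.\<close>
    also have "\<dots> = (\<Sum>m<2 * s - 1. (h ^ (m + 2) / fact (m + 1) *
        (real (m + 1) * (\<Sum>j=0..s. a' i j * c j ^ m))) *\<^sub>R D (m + 2) t)"
      by (intro sum.cong) (auto simp: divide_simps)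
    \<comment> \<open>The term added at index 0 vanishes through \<open>real m\<close>; it aligns
      the range with that of \<open>Sum1\<close>.\<close>
    also have "\<dots> = (\<Sum>m<Suc (2 * s - 1). (h ^ (m + 1) / fact m *
        (real m * (\<Sum>j=0..s. a' i j * c j ^ (m - 1)))) *\<^sub>R D (m + 1) t)"
      by (subst sum.lessThan_Suc_shift) simp
    also have "Suc (2 * s - 1) = 2 * s"
      using s by simp
    finally show ?thesis
      by (simp add: sum.atLeast1_atMost_eq diff_Suc)
  qed
  have "h *\<^sub>R (\<Sum>j=0..s. a i j *\<^sub>R P 1 j) + h\<^sup>2 *\<^sub>R (\<Sum>j=0..s. a' i j *\<^sub>R P 2 j)
      = (\<Sum>m=1..2 * s. ((c i * h) ^ m / fact m) *\<^sub>R D m t)"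
    unfolding Sum1 Sum2 sum.distrib[symmetric]
  proof (intro sum.cong refl)
    fix m assume m: "m \<in> {1..2 * s}"
    \<comment> \<open>Multiplied by h^m/(m - 1)!, the moment condition of order \<open>m\<close> is
      the equality of the coefficients of \<open>D m t\<close>.\<close>
    have "(\<Sum>j=0..s. a i j * c j ^ (m - 1)) + real (m - 1) * (\<Sum>j=0..s. a' i j * c j ^ (m - 2)) = c i ^ m / m"
      using moments m i unfolding hermite_moments_def by blast
    moreover have "(fact m :: real) = m * fact (m - 1)"
      using m by (simp add: fact_reduce)
    ultimately have "h ^ m / fact (m - 1) * (\<Sum>j=0..s. a i j * c j ^ (m - 1)) + h ^ m / fact (m - 1) *
        (real (m - 1) * (\<Sum>j=0..s. a' i j * c j ^ (m - 2))) = (c i * h) ^ m / fact m"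
      by (simp only: distrib_left[symmetric]) (simp add: power_mult_distrib mult_ac)
    then show "(h ^ m / fact (m - 1) * (\<Sum>j=0..s. a i j * c j ^ (m - 1))) *\<^sub>R D m t + (h ^ m / fact (m - 1) *
        (real (m - 1) * (\<Sum>j=0..s. a' i j * c j ^ (m - 2)))) *\<^sub>R D m t = ((c i * h) ^ m / fact m) *\<^sub>R D m t"
      by (simp only: scaleR_add_left[symmetric])
  qed
  then have eq: "D 0 (t + c i * h) - D 0 t - (h *\<^sub>R (\<Sum>j=0..s. a i j *\<^sub>R D 1 (t + c j * h))
      + h\<^sup>2 *\<^sub>R (\<Sum>j=0..s. a' i j *\<^sub>R D 2 (t + c j * h)))
      = R 0 i - (h *\<^sub>R (\<Sum>j=0..s. a i j *\<^sub>R R 1 j) + h\<^sup>2 *\<^sub>R (\<Sum>j=0..s. a' i j *\<^sub>R R 2 j))"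
    using Sum0 by (simp add: R_def algebra_simps sum_subtractf)
  \<comment> \<open>The remainders of u' and u'' are one and two orders lower, which their
    prefactors h and h^2 make up for.\<close>
  have h1: "h * h ^ (2 * s) = h ^ (2 * s + 1)" and h2: "h\<^sup>2 * h ^ (2 * s - 1) = h ^ (2 * s + 1)"
    using s by (simp_all add: power_add[symmetric])
  have "norm (h *\<^sub>R (\<Sum>j=0..s. a i j *\<^sub>R R 1 j)) \<le> h * (\<Sum>j=0..s. \<bar>a i j\<bar> * (B * h ^ (2 * s)))"
    using t R[of 1] by (auto intro!: mult_left_mono sum_norm_le)
  moreover have "norm (h\<^sup>2 *\<^sub>R (\<Sum>j=0..s. a' i j *\<^sub>R R 2 j)) \<le> h\<^sup>2 * (\<Sum>j=0..s. \<bar>a' i j\<bar> * (B * h ^ (2 * s - 1)))"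
    using t R[of 2] by (auto intro!: mult_left_mono sum_norm_le)
  moreover have "norm (R 0 i) \<le> B * h ^ (2 * s + 1)"
    using R[of 0 i] i by simp
  ultimately have "norm (R 0 i - (h *\<^sub>R (\<Sum>j=0..s. a i j *\<^sub>R R 1 j) + h\<^sup>2 *\<^sub>R (\<Sum>j=0..s. a' i j *\<^sub>R R 2 j)))
      \<le> B * h ^ (2 * s + 1) + (h * (\<Sum>j=0..s. \<bar>a i j\<bar> * (B * h ^ (2 * s)))
        + h\<^sup>2 * (\<Sum>j=0..s. \<bar>a' i j\<bar> * (B * h ^ (2 * s - 1))))"
    by (intro order_trans[OF norm_triangle_ineq4] add_mono order_trans[OF norm_triangle_ineq])
  also have "\<dots> = B * h ^ (2 * s + 1) * (1 + (\<Sum>j=0..s. \<bar>a i j\<bar> + \<bar>a' i j\<bar>))"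
    unfolding h1[symmetric] sum.distrib sum_distrib_right[symmetric]
    using h1 h2 by (simp add: algebra_simps)
  also have "\<dots> \<le> B * h ^ (2 * s + 1) * (1 + (\<Sum>j=0..s. A))"
    using A \<open>0 \<le> B\<close> t by (intro mult_left_mono add_left_mono sum_mono) auto
  finally show ?thesis
    unfolding eq by (simp add: mult_ac add_ac)
qed

section \<open>Lipschitz constants, error accumulation, change of step size, derivatives of the
  solution\<close>

text \<open>The directional derivatives along \<open>Basis\<close> are continuous, hence bounded on
  \<open>N\<close>, and the sum of these bounds controls the operator norm. The mean value
  inequality wants convexity, which a union of balls may lack; hence one constant for all convex
  subsets of \<open>N\<close>.\<close>

lemma C1_lipschitz_compact:
  fixes f :: "'a::euclidean_space \<Rightarrow> 'b::real_normed_vector"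
  assumes "Ck_on 1 f U" "compact N" "N \<subseteq> U"
  obtains M where "0 \<le> M"
    "\<And>S x y. convex S \<Longrightarrow> S \<subseteq> N \<Longrightarrow> x \<in> S \<Longrightarrow> y \<in> S \<Longrightarrow> norm (f x - f y) \<le> M * norm (x - y)"
proof -
  let ?f' = "\<lambda>x. frechet_derivative f (at x)"
  have "\<exists>M. \<forall>x\<in>N. norm (?f' x b) \<le> M" for b
  proof -
    have "continuous_on N (\<lambda>x. ?f' x b)"
      using assms by (auto intro: continuous_on_subset)
    then have "bounded ((\<lambda>x. ?f' x b) ` N)"
      using \<open>compact N\<close> by (intro compact_imp_bounded compact_continuous_image)
    then show ?thesis by (auto simp: bounded_iff)
  qed
  then obtain m where m: "\<And>b x. x \<in> N \<Longrightarrow> norm (?f' x b) \<le> m b"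
    by metis
  \<comment> \<open>The absolute value secures nonnegativity also for empty \<open>N\<close>, where
    the \<open>m b\<close> are arbitrary.\<close>
  define M where "M = \<bar>\<Sum>b\<in>Basis. m b\<bar>"
  have der: "(f has_derivative ?f' x) (at x)" if "x \<in> N" for x
    using assms that by (auto simp: frechet_derivative_works)
  have "onorm (?f' x) \<le> M" if "x \<in> N" for x
  proof -
    have "onorm (?f' x) \<le> (\<Sum>b\<in>Basis. norm (?f' x b))"
      using der[OF that] by (intro onorm_componentwise has_derivative_bounded_linear)
    also have "\<dots> \<le> (\<Sum>b\<in>Basis. m b)"
      using m[OF that] by (intro sum_mono)
    finally show ?thesis by (simp add: M_def)
  qed
  then have "norm (f x - f y) \<le> M * norm (x - y)"
    if "convex S" "S \<subseteq> N" "x \<in> S" "y \<in> S" for S x y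
    using that der by (intro differentiable_bound[where f' = ?f' and S = S])
      (auto intro: has_derivative_at_withinI)
  then show thesis
    by (intro that[of M]) (simp_all add: M_def)
qed

text \<open>Gronwall's inequality, used as a bootstrap: the one-step estimate is available only as long
  as the error stays below the radius \<open>\<rho>\<close>.\<close>

lemma discrete_gronwall:
  fixes e :: "nat \<Rightarrow> real"
  assumes "e 0 \<le> 0" "0 \<le> C" "0 \<le> b" "0 \<le> h"
    and step: "\<And>n. real (Suc n) * h \<le> T \<Longrightarrow> e n < \<rho> \<Longrightarrow> e (Suc n) \<le> (1 + C * h) * e n + h * b"
    and small: "T * exp (C * T) * b < \<rho>"
    and n: "real n * h \<le> T"
  shows "e n \<le> T * exp (C * T) * b" "e n < \<rho>"
proof -
  have exp_le: "(1 + C * h) ^ n \<le> exp (C * T)" if "real n * h \<le> T" for n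
  proof -
    have "(1 + C * h) ^ n \<le> exp (C * h) ^ n"
      using assms by (intro power_mono exp_ge_add_one_self) auto
    also have "\<dots> = exp (C * (real n * h))"
      by (simp add: exp_of_nat_mult[symmetric] mult_ac)
    also have "\<dots> \<le> exp (C * T)"
      using that \<open>0 \<le> C\<close> by (simp add: mult_left_mono)
    finally show ?thesis .
  qed
  have bound: "real n * h * (1 + C * h) ^ n * b \<le> T * exp (C * T) * b" if "real n * h \<le> T" for n
    using that exp_le[OF that] assms by (intro mult_right_mono mult_mono) (auto intro: order_trans[rotated])
  \<comment> \<open>This form avoids the division by \<open>C\<close> in the geometric sum and so
    covers \<open>C = 0\<close>.\<close>
  have "e n \<le> real n * h * (1 + C * h) ^ n * b"
    using n
  proof (induction n)
    case 0
    then show ?case using assms by simp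
  next
    case (Suc n)
    then have n: "real n * h \<le> T"
      using \<open>0 \<le> h\<close> by (simp add: algebra_simps)
    note IH = Suc.IH[OF n]
    \<comment> \<open>The bootstrap: the bound already obtained for \<open>n\<close> lies below
      \<open>\<rho>\<close> and permits the next step.\<close>
    have "e n < \<rho>"
      using IH bound[OF n] small by linarith
    from step[OF Suc.prems this] have "e (Suc n) \<le> (1 + C * h) * e n + h * b" .
    also have "\<dots> \<le> (1 + C * h) * (real n * h * (1 + C * h) ^ n * b) + (1 + C * h) ^ Suc n * (h * b)"
    proof (intro add_mono mult_left_mono IH)
      have "1 \<le> (1 + C * h) ^ Suc n"
        using assms by (intro one_le_power) simp
      from mult_right_mono[OF this, of "h * b"] show "h * b \<le> (1 + C * h) ^ Suc n * (h * b)"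
        using assms by simp
    qed (use assms in auto)
    also have "\<dots> = real (Suc n) * h * (1 + C * h) ^ Suc n * b"
      by (simp add: algebra_simps)
    finally show ?case .
  qed
  with bound[OF n] small show "e n \<le> T * exp (C * T) * b" "e n < \<rho>"
    by linarith+
qed

text \<open>Serves continuity in the step size: stages for \<open>h'\<close>, put into the equations
  for \<open>h\<close>, have this difference as residual up to sign. The constant 3 is 1 + 2, with 2
  bounding h + h'.\<close>

lemma stage_map_diff_step:
  assumes "0 \<le> h" "h \<le> 1" "0 \<le> h'" "h' \<le> 1"
    and A: "\<And>j. j \<le> s \<Longrightarrow> \<bar>a i j\<bar> + \<bar>a' i j\<bar> \<le> A"
    and F: "\<And>j. j \<le> s \<Longrightarrow> norm (F (Z j)) \<le> B" and G: "\<And>j. j \<le> s \<Longrightarrow> norm (G (Z j)) \<le> B"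
  shows "norm (stage_map s a a' F G h Z i - stage_map s a a' F G h' Z i) \<le> 3 * ((real s + 1) * (A * B)) * \<bar>h - h'\<bar>"
proof -
  define S where "S = (\<Sum>j=0..s. a i j *\<^sub>R F (Z j))"
  define S' where "S' = (\<Sum>j=0..s. a' i j *\<^sub>R G (Z j))"
  have le: "\<bar>a i j\<bar> * norm (F (Z j)) \<le> A * B" "\<bar>a' i j\<bar> * norm (G (Z j)) \<le> A * B" if "j \<le> s" for j
    using A[OF that] F[OF that] G[OF that] by (auto intro!: mult_mono)
  have "norm S \<le> (\<Sum>j=0..s. A * B)" "norm S' \<le> (\<Sum>j=0..s. A * B)"
    unfolding S_def S'_def by (rule sum_norm_le; use le in simp)+
  then have S: "norm S \<le> (real s + 1) * (A * B)" "norm S' \<le> (real s + 1) * (A * B)"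
    by (simp_all add: add.commute)
  have "\<bar>h\<^sup>2 - h'\<^sup>2\<bar> = \<bar>h - h'\<bar> * (h + h')"
    using assms by (simp add: power2_eq_square square_diff_square_factored abs_mult)
  also have "\<dots> \<le> \<bar>h - h'\<bar> * 2"
    using assms by (intro mult_left_mono) auto
  finally have h2: "\<bar>h\<^sup>2 - h'\<^sup>2\<bar> \<le> \<bar>h - h'\<bar> * 2" .
  have "stage_map s a a' F G h Z i - stage_map s a a' F G h' Z i = (h - h') *\<^sub>R S + (h\<^sup>2 - h'\<^sup>2) *\<^sub>R S'"
    by (simp add: stage_map_def S_def S'_def algebra_simps)
  also have "norm \<dots> \<le> \<bar>h - h'\<bar> * norm S + \<bar>h\<^sup>2 - h'\<^sup>2\<bar> * norm S'"
    by (intro norm_triangle_le) simp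
  also have "\<dots> \<le> \<bar>h - h'\<bar> * ((real s + 1) * (A * B)) + (\<bar>h - h'\<bar> * 2) * ((real s + 1) * (A * B))"
    using S h2 by (intro add_mono mult_mono) auto
  finally show ?thesis
    by (simp add: algebra_simps)
qed

text \<open>\<open>D\<close> is merely some chain of derivatives. Derivatives within a nondegenerate
  interval are unique, end points included; this identifies \<open>D 1\<close> through the equation
  and \<open>D 2\<close> through the chain rule, and links the field values used by the method to
  the Taylor expansion of \<open>u\<close>.\<close>

lemma solution_derivs:
  assumes "T > 0" and U: "\<And>t. t \<in> {0..T} \<Longrightarrow> L differentiable (at (u t))" and sol: "solves_on L u T"
    and D0: "D 0 = u"
    and D: "\<And>m t. m < 2 \<Longrightarrow> t \<in> {0..T} \<Longrightarrow> (D m has_vector_derivative D (Suc m) t) (at t within {0..T})"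
    and t: "t \<in> {0..T}"
  shows "D 1 t = L (u t)" "D 2 t = total_deriv L (u t)"
proof -
  have uniq: "x = y" if "t \<in> {0..T}" "(f has_vector_derivative x) (at t within {0..T})"
    "(f has_vector_derivative y) (at t within {0..T})" for f :: "real \<Rightarrow> 'a" and x y t
    using vector_derivative_unique_within_closed_interval[of 0 T] that \<open>T > 0\<close> by auto
  have D1: "D 1 t = L (u t)" if t: "t \<in> {0..T}" for t
    using uniq[OF t, of u] D[of 0 t] sol t D0 by (simp add: solves_on_def)
  then show "D 1 t = L (u t)"
    using t .
  have "(u has_derivative (\<lambda>x. x *\<^sub>R L (u t))) (at t within {0..T})"
    using sol t by (simp add: solves_on_def has_vector_derivative_def)
  moreover have "(L has_derivative frechet_derivative L (at (u t))) (at (u t) within u ` {0..T})"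
    using U[OF t] by (auto simp: frechet_derivative_works intro: has_derivative_at_withinI)
  ultimately have "((\<lambda>t. L (u t)) has_derivative (\<lambda>x. frechet_derivative L (at (u t)) (x *\<^sub>R L (u t))))
      (at t within {0..T})"
    by (rule has_derivative_in_compose)
  moreover have "(\<lambda>x. frechet_derivative L (at (u t)) (x *\<^sub>R L (u t))) = (\<lambda>x. x *\<^sub>R total_deriv L (u t))"
    by (simp add: total_deriv_def linear_cmul[OF linear_frechet_derivative[OF U[OF t]]])
  ultimately have "((\<lambda>t. L (u t)) has_vector_derivative total_deriv L (u t)) (at t within {0..T})"
    by (simp add: has_vector_derivative_def)
  then have "(D 1 has_vector_derivative total_deriv L (u t)) (at t within {0..T})"
    using t D1 by (rule has_vector_derivative_transform[rotated -1])
  moreover have "(D 1 has_vector_derivative D 2 t) (at t within {0..T})"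
    using D[of 1 t] t by (simp add: numeral_2_eq_2)
  ultimately show "D 2 t = total_deriv L (u t)"
    using uniq[OF t] by blast
qed

lemma eventually_mult_less_at_right_0:
  fixes q d :: real
  assumes "0 < d"
  shows "\<forall>\<^sub>F h in at_right 0. h * q < d"
proof -
  have "((\<lambda>h. h * q) \<longlongrightarrow> 0) (at_right 0)"
    by (auto intro!: tendsto_eq_intros)
  then show ?thesis
    using assms by (rule order_tendstoD)
qed

theorem theorem3p2:
  fixes s :: nat
    and c :: "nat \<Rightarrow> real"
    and a a' :: "nat \<Rightarrow> nat \<Rightarrow> real"
  assumes "s \<ge> 1"
    and "c 0 = 0" and "c s = 1" and "\<And>i. i < s \<Longrightarrow> c i < c (Suc i)"
    and "hermite_moments s c a a'"
  shows "\<exists>k. \<forall>(L :: 'a::euclidean_space \<Rightarrow> 'a) (U :: 'a set) (u :: real \<Rightarrow> 'a) (T :: real).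
           T > 0 \<and> open U \<and> u ` {0..T} \<subseteq> U \<and>
           Ck_on k L U \<and> Ck_on k (total_deriv L) U \<and>
           solves_on L u T \<and> has_bounded_derivs (2 * s + 1) u T \<longrightarrow>
           (\<exists>h0 > 0. \<exists>r > 0. \<exists>V Y.
              open V \<and> u ` {0..T} \<subseteq> V \<and>
              locally_unique_branch s a a' L U V r h0 Y \<and>
              (\<exists>C. \<forall>h\<in>{0<..h0}. \<forall>n. real (Suc n) * h \<le> T \<longrightarrow>
                 norm (Y h (u (real n * h)) s - u (real (Suc n) * h)) \<le> C * h ^ (2 * s + 1)) \<and>
              (\<forall>h\<in>{0<..h0}. \<forall>n. real n * h \<le> T \<longrightarrow> num_sol s Y h (u 0) n \<in> V) \<and>
              (\<exists>C. \<forall>h\<in>{0<..h0}.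
                 (MAX n\<in>{n. real n \<le> T / h}. norm (num_sol s Y h (u 0) n - u (real n * h)))
                   \<le> C * h ^ (2 * s)))"
proof (rule exI[of _ 1], intro allI impI, elim conjE)
  \<comment> \<open>\<open>k = 1\<close> works: smoothness of the two fields enters through local
    Lipschitz constants, bounds and the chain rule, while the high order rests on the derivatives of
    \<open>u\<close>.\<close>
  fix L :: "'a \<Rightarrow> 'a" and U u T
  assume T: "T > 0" and U: "open U" "u ` {0..T} \<subseteq> U"
    and smooth: "Ck_on 1 L U" "Ck_on 1 (total_deriv L) U"
    and sol: "solves_on L u T" and bdd: "has_bounded_derivs (2 * s + 1) u T"
  let ?G = "total_deriv L"
  let ?\<Psi> = "stage_map s a a' L ?G"

  \<comment> \<open>The exact solution, a tube around it, and uniform constants\<close>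
  have c: "0 \<le> c j \<and> c j \<le> 1" if "j \<le> s" for j
  proof -
    have mono: "c i \<le> c j" if "i \<le> j" "j \<le> s" for i j
      using that
    proof (induction j rule: dec_induct)
      case (step j)
      then show ?case using assms(4)[of j] by simp
    qed simp
    show ?thesis using mono[of 0 j] mono[of j s] that assms(2,3) by simp
  qed
  obtain D where D0: "D 0 = u"
    and D: "\<And>m t. m < 2 * s + 1 \<Longrightarrow> t \<in> {0..T} \<Longrightarrow> (D m has_vector_derivative D (Suc m) t) (at t within {0..T})"
    and Dbdd: "\<And>m. m \<le> 2 * s + 1 \<Longrightarrow> bounded (D m ` {0..T})"
    using bdd unfolding has_bounded_derivs_def by metis
  obtain Bu where Bu: "\<And>m t. m \<le> 2 * s + 1 \<Longrightarrow> t \<in> {0..T} \<Longrightarrow> norm (D m t) \<le> Bu"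
  proof -
    have "bounded (\<Union>m\<le>2 * s + 1. D m ` {0..T})"
      using Dbdd by (intro bounded_UN) auto
    then obtain B where "\<forall>x\<in>(\<Union>m\<le>2 * s + 1. D m ` {0..T}). norm x \<le> B"
      by (auto simp: bounded_iff)
    then show thesis by (intro that[of B]) auto
  qed
  have "0 \<le> Bu"
    by (rule order_trans[OF norm_ge_zero Bu[of 0 0]]) (use T in auto)
  have diff_L: "L differentiable (at (u t))" if "t \<in> {0..T}" for t
    using smooth(1) U that by (auto simp: image_subset_iff)
  have D12: "D 1 t = L (u t)" "D 2 t = ?G (u t)" if "t \<in> {0..T}" for t
    by (rule solution_derivs[where T = T and u = u and L = L and D = D];
        use T diff_L sol D0 D \<open>s \<ge> 1\<close> that in simp)+
  define K where "K = u ` {0..T}"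
  have "compact K"
  proof -
    have "continuous_on {0..T} u"
      using D[of 0] D0 by (intro continuous_on_vector_derivative) auto
    then show ?thesis by (simp add: K_def compact_continuous_image)
  qed
  \<comment> \<open>Compactness of the curve gives a tube of uniform radius inside \<open>U\<close>.
    The balls \<open>ball x R\<close> centred on the curve are convex subsets of it, so all of them
    share one Lipschitz constant.\<close>
  then obtain R where "R > 0" and R: "(\<Union>x\<in>K. cball x R) \<subseteq> U"
    using compact_subset_open_imp_cball_epsilon_subset U unfolding K_def by metis
  define N where "N = (\<Union>x\<in>K. cball x R)"
  have N: "compact N" "N \<subseteq> U"
    using R compact_minkowski_sum_cball[OF \<open>compact K\<close>] by (auto simp: N_def)
  have ball_RN: "ball x R \<subseteq> N" if "x \<in> K" for x
    using that ball_subset_cball by (auto simp: N_def)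
  obtain M where "0 \<le> M"
    and lip: "\<And>x p q. x \<in> K \<Longrightarrow> p \<in> ball x R \<Longrightarrow> q \<in> ball x R \<Longrightarrow> norm (L p - L q) \<le> M * norm (p - q)"
      "\<And>x p q. x \<in> K \<Longrightarrow> p \<in> ball x R \<Longrightarrow> q \<in> ball x R \<Longrightarrow> norm (?G p - ?G q) \<le> M * norm (p - q)"
  proof -
    obtain M1 where M1: "0 \<le> M1" "\<And>S x y. convex S \<Longrightarrow> S \<subseteq> N \<Longrightarrow> x \<in> S \<Longrightarrow> y \<in> S \<Longrightarrow> norm (L x - L y) \<le> M1 * norm (x - y)"
      using C1_lipschitz_compact[OF smooth(1) N] by blast
    obtain M2 where M2: "0 \<le> M2" "\<And>S x y. convex S \<Longrightarrow> S \<subseteq> N \<Longrightarrow> x \<in> S \<Longrightarrow> y \<in> S \<Longrightarrow> norm (?G x - ?G y) \<le> M2 * norm (x - y)"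
      using C1_lipschitz_compact[OF smooth(2) N] by blast
    show thesis
    proof (rule that[of "M1 + M2"])
      fix x p q assume *: "x \<in> K" "p \<in> ball x R" "q \<in> ball x R"
      have "norm (L p - L q) \<le> M1 * norm (p - q)" "norm (?G p - ?G q) \<le> M2 * norm (p - q)"
        using M1(2) M2(2) convex_ball ball_RN * by blast+
      moreover have "0 \<le> M1 * norm (p - q)" "0 \<le> M2 * norm (p - q)"
        using M1(1) M2(1) by simp_all
      ultimately show "norm (L p - L q) \<le> (M1 + M2) * norm (p - q)" "norm (?G p - ?G q) \<le> (M1 + M2) * norm (p - q)"
        unfolding distrib_right by linarith+
    qed (use M1(1) M2(1) in simp)
  qed
  obtain B where B: "\<And>x. x \<in> N \<Longrightarrow> norm (L x) \<le> B" "\<And>x. x \<in> N \<Longrightarrow> norm (?G x) \<le> B"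
  proof -
    have "continuous_on N L" "continuous_on N ?G"
      using smooth N(2) by (auto intro!: continuous_at_imp_continuous_on differentiable_imp_continuous_within)
    then have "bounded (L ` N \<union> ?G ` N)"
      using N(1) by (auto intro!: compact_imp_bounded compact_continuous_image)
    then show thesis
      using that unfolding bounded_iff by blast
  qed
  obtain A where "0 \<le> A" and A: "\<And>i j. i \<in> {1..s} \<Longrightarrow> j \<le> s \<Longrightarrow> \<bar>a i j\<bar> + \<bar>a' i j\<bar> \<le> A"
  proof
    let ?f = "\<lambda>(i, j). \<bar>a i j\<bar> + \<bar>a' i j\<bar>"
    show "0 \<le> sum ?f ({1..s} \<times> {..s})"
      by (intro sum_nonneg) auto
    show "\<bar>a i j\<bar> + \<bar>a' i j\<bar> \<le> sum ?f ({1..s} \<times> {..s})" if "i \<in> {1..s}" "j \<le> s" for i j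
      using member_le_sum[of "(i, j)" "{1..s} \<times> {..s}" ?f] that by auto
  qed
  \<comment> \<open>\<open>C1\<close> is the rate in \<open>stage_stability\<close>;
    \<open>C2\<close> is the constant of \<open>hermite_residual_bound\<close> times the factor 2
    that stability puts on residuals.\<close>
  define C1 where "C1 = 2 * (real s + 1) * (A * M)"
  define C2 where "C2 = 2 * ((1 + (real s + 1) * A) * Bu)"
  have "0 \<le> C1" "0 \<le> C2"
    using \<open>0 \<le> A\<close> \<open>0 \<le> M\<close> \<open>0 \<le> Bu\<close> by (simp_all add: C1_def C2_def)
  \<comment> \<open>Two radii \<open>r\<close> fit into \<open>R\<close>: a point within
    \<open>r\<close> of the curve carries a ball of radius \<open>r\<close> inside some
    \<open>ball x R\<close>.\<close>
  define r where "r = R / 3"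
  have "r > 0"
    using \<open>R > 0\<close> by (simp add: r_def)
  define V where "V = (\<Union>x\<in>K. ball x r)"
  have "K \<subseteq> V"
    using \<open>r > 0\<close> by (auto simp: V_def)
  have V_K: "\<exists>x\<in>K. ball y r \<subseteq> ball x R" if "y \<in> V" for y
  proof -
    obtain x where "x \<in> K" "dist x y < r"
      using \<open>y \<in> V\<close> by (auto simp: V_def)
    moreover have "ball y r \<subseteq> ball x R"
      by (subst ball_subset_ball_iff) (use \<open>dist x y < r\<close> \<open>r > 0\<close> in \<open>auto simp: r_def dist_commute\<close>)
    ultimately show ?thesis by blast
  qed
  have ball_N: "ball y r \<subseteq> N" if "y \<in> V" for y
    using V_K[OF that] ball_RN by blast
  \<comment> \<open>In turn: h^2 <= h; absorption and contraction; Picard iterates stay within r/2;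
    exact values at the nodes stay within \<open>R\<close> of u(t); the global error stays below
    \<open>r\<close>.\<close>
  obtain h0 where "h0 > 0" and small: "\<And>h. h \<in> {0<..h0} \<Longrightarrow> h < 1 \<and> 2 * (real s * (h * A * M)) \<le> 1 \<and>
      h * A * ((real s + 1) * B) \<le> r / 2 \<and> Bu * h < R \<and> T * exp (C1 * T) * C2 * h < r"
  proof -
    have "\<forall>\<^sub>F h in at_right 0. h * 1 < 1 \<and> h * (2 * (real s * (A * M))) < 1 \<and>
        h * (A * ((real s + 1) * B)) < r / 2 \<and> h * Bu < R \<and> h * (T * exp (C1 * T) * C2) < r"
      using \<open>r > 0\<close> \<open>R > 0\<close> by (intro eventually_conj eventually_mult_less_at_right_0) auto
    then obtain b where "b > 0" and b: "\<And>h. 0 < h \<Longrightarrow> h < b \<Longrightarrow> h * 1 < 1 \<and> h * (2 * (real s * (A * M))) < 1 \<and>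
        h * (A * ((real s + 1) * B)) < r / 2 \<and> h * Bu < R \<and> h * (T * exp (C1 * T) * C2) < r"
      unfolding eventually_at_right_field by blast
    show thesis
    proof (rule that[of "b / 2"])
      fix h assume "h \<in> {0<..b / 2}"
      then show "h < 1 \<and> 2 * (real s * (h * A * M)) \<le> 1 \<and>
          h * A * ((real s + 1) * B) \<le> r / 2 \<and> Bu * h < R \<and> T * exp (C1 * T) * C2 * h < r"
        using b[of h] \<open>b > 0\<close> by (simp add: mult_ac)
    qed (use \<open>b > 0\<close> in simp)
  qed
  have stab: "norm (Z i - Z' i) \<le> (1 + C1 * h) * norm (Z 0 - Z' 0) + 2 * \<epsilon>"
    if "h \<in> {0<..h0}" "x \<in> K" "\<And>j. j \<le> s \<Longrightarrow> Z j \<in> ball x R" "\<And>j. j \<le> s \<Longrightarrow> Z' j \<in> ball x R"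
      "\<And>i. i \<in> {1..s} \<Longrightarrow> norm ((Z i - Z 0 - ?\<Psi> h Z i) - (Z' i - Z' 0 - ?\<Psi> h Z' i)) \<le> \<epsilon>" "i \<in> {1..s}"
    for h x Z Z' \<epsilon> i
    unfolding C1_def
    by (rule stage_stability[where W = "ball x R" and F = L and G = ?G])
      (use that small[OF that(1)] A lip[OF that(2)] \<open>0 \<le> M\<close> \<open>0 \<le> A\<close> in auto)
  \<comment> \<open>Stages are sought in the closed ball of radius r/2, hence lie in the open ball
    of radius \<open>r\<close>. Uniqueness there, shown below, makes the choice immaterial for the
    indices in \<open>{1..s}\<close>.\<close>
  define Y where "Y h y = (SOME Z. Z 0 = y \<and> (\<forall>i\<in>{1..s}. Z i \<in> cball y (r / 2) \<and> Z i = y + ?\<Psi> h Z i))" for h y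
  have Y: "Y h y 0 = y \<and> (\<forall>i\<in>{1..s}. Y h y i \<in> cball y (r / 2) \<and> Y h y i = y + ?\<Psi> h (Y h y) i)"
    if "h \<in> {0<..h0}" "y \<in> V" for h y
  proof -
    obtain x where "x \<in> K" "ball y r \<subseteq> ball x R"
      using V_K \<open>y \<in> V\<close> by blast
    moreover have "cball y (r / 2) \<subseteq> ball y r"
      using \<open>r > 0\<close> by auto
    ultimately have "cball y (r / 2) \<subseteq> ball x R" "cball y (r / 2) \<subseteq> N"
      using ball_N[OF \<open>y \<in> V\<close>] by blast+
    then have "\<exists>Z. Z 0 = y \<and> (\<forall>i\<in>{1..s}. Z i \<in> cball y (r / 2) \<and> Z i = y + ?\<Psi> h Z i)"
      using that(1) small[OF that(1)] \<open>r > 0\<close>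
      by (intro stage_exists[where A = A and M = M and B = B] A lip[OF \<open>x \<in> K\<close>] B) (force simp del: mem_cball)+
    then show ?thesis
      unfolding Y_def by (rule someI_ex)
  qed
  have Y0: "Y h y 0 = y" and Y_ball: "\<And>j. j \<le> s \<Longrightarrow> Y h y j \<in> ball y r"
    and Y_eq: "\<And>i. i \<in> {1..s} \<Longrightarrow> Y h y i = y + ?\<Psi> h (Y h y) i"
    if "h \<in> {0<..h0}" "y \<in> V" for h y
  proof -
    show "Y h y 0 = y"
      using Y[OF that] by blast
    show "Y h y j \<in> ball y r" if "j \<le> s" for j
    proof (cases "j = 0")
      case False
      then have "j \<in> {1..s}"
        using that by simp
      then have "Y h y j \<in> cball y (r / 2)"
        using Y[OF \<open>h \<in> {0<..h0}\<close> \<open>y \<in> V\<close>] by blast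
      then show ?thesis
        using \<open>r > 0\<close> by simp
    qed (use Y[OF \<open>h \<in> {0<..h0}\<close> \<open>y \<in> V\<close>] \<open>r > 0\<close> in simp)
    show "Y h y i = y + ?\<Psi> h (Y h y) i" if "i \<in> {1..s}" for i
      using Y[OF \<open>h \<in> {0<..h0}\<close> \<open>y \<in> V\<close>] that by blast
  qed
  have Y_bound: "norm (L (Y h y j)) \<le> B" "norm (?G (Y h y j)) \<le> B" if "h \<in> {0<..h0}" "y \<in> V" "j \<le> s" for h y j
    using B Y_ball[OF that] ball_N[OF \<open>y \<in> V\<close>] by blast+

  \<comment> \<open>The locally unique branch: uniqueness, continuity in the step size, uniform
    limit\<close>
  have branch: "locally_unique_branch s a a' L U V r h0 Y"
    unfolding locally_unique_branch_def
  proof (intro conjI ballI allI impI)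
    fix y assume "y \<in> V"
    then show "ball y r \<subseteq> U"
      using ball_N N by blast
  next
    fix y h i assume *: "y \<in> V" "h \<in> {0<..h0}"
    show "Y h y 0 = y"
      using Y0 * by blast
    show "Y h y i \<in> ball y r" if "i \<in> {1..s}"
      using Y_ball * that by simp
    show "stage_system s a a' L h (Y h y)"
      unfolding stage_system_iff using Y_eq Y0 * by simp
  next
    fix y h Z i
    assume *: "y \<in> V" "h \<in> {0<..h0}" and i: "i \<in> {1..s}"
      and Z: "Z 0 = y \<and> (\<forall>i\<in>{1..s}. Z i \<in> ball y r) \<and> stage_system s a a' L h Z"
    obtain x where x: "x \<in> K" "ball y r \<subseteq> ball x R"
      using V_K * by blast
    have "Z j \<in> ball y r" if "j \<le> s" for j
      using Z that \<open>r > 0\<close> by (cases "j = 0") auto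
    moreover have "norm ((Z i - Z 0 - ?\<Psi> h Z i) - (Y h y i - Y h y 0 - ?\<Psi> h (Y h y) i)) \<le> 0" if "i \<in> {1..s}" for i
    proof -
      have "Z i = Z 0 + ?\<Psi> h Z i"
        using Z that unfolding stage_system_iff by blast
      then have "Z i - Z 0 - ?\<Psi> h Z i = 0"
        by (simp add: algebra_simps)
      moreover have "Y h y i - Y h y 0 - ?\<Psi> h (Y h y) i = 0"
        using Y_eq[OF *(2,1) that] Y0[OF *(2,1)] by (simp add: algebra_simps)
      ultimately show ?thesis by simp
    qed
    \<comment> \<open>Equal initial values and vanishing residuals make the right-hand side
      zero.\<close>
    ultimately have "norm (Z i - Y h y i) \<le> (1 + C1 * h) * norm (Z 0 - Y h y 0) + 2 * 0"
      using i x Y_ball[OF *(2,1)] by (intro stab[OF *(2) x(1)]) blast+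
    then show "Z i = Y h y i"
      using Z Y0[OF *(2,1)] by simp
  next
    fix i y assume i: "i \<in> {1..s}" and y: "y \<in> V"
    obtain x where x: "x \<in> K" "ball y r \<subseteq> ball x R"
      using V_K y by blast
    define Q where "Q = 3 * ((real s + 1) * (A * B))"
    have lip_h: "norm (Y h y i - Y h' y i) \<le> 2 * Q * \<bar>h - h'\<bar>" if h: "h \<in> {0<..h0}" "h' \<in> {0<..h0}" for h h'
    proof -
      have "norm ((Y h y i - Y h y 0 - ?\<Psi> h (Y h y) i) - (Y h' y i - Y h' y 0 - ?\<Psi> h (Y h' y) i)) \<le> Q * \<bar>h - h'\<bar>"
        if i: "i \<in> {1..s}" for i
      proof -
        have "Y h y i - Y h y 0 - ?\<Psi> h (Y h y) i = 0"
          using Y_eq[OF h(1) y i] Y0[OF h(1) y] by (simp add: algebra_simps)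
        moreover have "Y h' y i - Y h' y 0 = ?\<Psi> h' (Y h' y) i"
          using Y_eq[OF h(2) y i] Y0[OF h(2) y] by (simp add: algebra_simps)
        moreover have "norm (?\<Psi> h (Y h' y) i - ?\<Psi> h' (Y h' y) i) \<le> Q * \<bar>h - h'\<bar>"
          unfolding Q_def
          by (rule stage_map_diff_step) (use h small[OF h(1)] small[OF h(2)] A[OF i] Y_bound[OF h(2) y] in auto)
        ultimately show ?thesis by simp
      qed
      then have "norm (Y h y i - Y h' y i) \<le> (1 + C1 * h) * norm (Y h y 0 - Y h' y 0) + 2 * (Q * \<bar>h - h'\<bar>)"
        using i x Y_ball[OF h(1) y] Y_ball[OF h(2) y] by (intro stab[OF h(1) x(1)]) blast+
      then show ?thesis
        using Y0 h y by simp
    qed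
    have "\<bar>2 * Q\<bar>-lipschitz_on {0<..h0} (\<lambda>h. Y h y i)"
    proof (rule lipschitz_onI)
      fix h h' assume "h \<in> {0<..h0}" "h' \<in> {0<..h0}"
      from lip_h[OF this] mult_right_mono[OF abs_ge_self[of "2 * Q"] abs_ge_zero[of "h - h'"]]
      show "dist (Y h y i) (Y h' y i) \<le> \<bar>2 * Q\<bar> * dist h h'"
        by (simp add: dist_norm)
    qed simp
    then show "continuous_on {0<..h0} (\<lambda>h. Y h y i)"
      by (rule lipschitz_on_continuous_on)
  next
    fix i assume i: "i \<in> {1..s}"
    show "uniform_limit V (\<lambda>h y. Y h y i) (\<lambda>y. y) (at_right 0)"
      unfolding uniform_limit_iff
    proof (intro allI impI)
      fix e :: real assume "e > 0"
      have "\<forall>\<^sub>F h in at_right 0. h * (A * ((real s + 1) * B)) < e \<and> h \<in> {0<..<h0}"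
        using \<open>e > 0\<close> \<open>h0 > 0\<close> by (intro eventually_conj eventually_mult_less_at_right_0 eventually_at_right_real)
      then show "\<forall>\<^sub>F h in at_right 0. \<forall>y\<in>V. dist (Y h y i) y < e"
      proof (rule eventually_mono, intro ballI)
        fix h y assume h: "h * (A * ((real s + 1) * B)) < e \<and> h \<in> {0<..<h0}" and y: "y \<in> V"
        then have h': "h \<in> {0<..h0}"
          by simp
        \<comment> \<open>The bound is independent of \<open>y\<close>, which makes the limit
          uniform on \<open>V\<close>.\<close>
        have "norm (?\<Psi> h (Y h y) i) \<le> h * A * (\<Sum>j=0..s. B)"
          unfolding stage_map_def
          by (rule norm_stage_sum_le) (use h' small[OF h'] A[OF i] Y_bound[OF h' y] in auto)
        also have "\<dots> = h * (A * ((real s + 1) * B))"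
          by (simp add: algebra_simps)
        finally show "dist (Y h y i) y < e"
          using h Y_eq[OF h' y i] by (simp add: dist_norm)
      qed
    qed
  qed

  \<comment> \<open>Local and global error\<close>
  have u_K: "u t \<in> K" if "t \<in> {0..T}" for t
    using that by (simp add: K_def)
  have grid: "real n * h \<in> {0..T}" if "real n * h \<le> T" "h \<in> {0<..h0}" for n h
    using that by simp
  have prev: "real n * h \<le> T" "real n * h + h \<le> T" if "real (Suc n) * h \<le> T" "h \<in> {0<..h0}" for n h
    using that by (simp_all add: algebra_simps)
  have local_error: "norm (Y h (u (real n * h)) s - u (real (Suc n) * h)) \<le> C2 * h ^ (2 * s + 1)"
    if h: "h \<in> {0<..h0}" and n: "real (Suc n) * h \<le> T" for h n
  proof -
    define t where "t = real n * h"
    \<comment> \<open>The exact values at the nodes are compared with the computed stages; as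
      \<open>c 0 = 0\<close> and \<open>c s = 1\<close>, they begin with the exact initial value and
      end with the exact value after the step.\<close>
    define Z where "Z j = u (t + c j * h)" for j
    have t: "t \<in> {0..T}" "t + h \<le> T" "0 \<le> t"
      using grid[OF prev(1)[OF n h] h] prev(2)[OF n h] h by (auto simp: t_def)
    have y: "u t \<in> V"
      using u_K t \<open>K \<subseteq> V\<close> by blast
    have tc: "0 \<le> c j * h" "c j * h \<le> h" if "j \<le> s" for j
      using c[OF that] h by (auto simp: mult_left_le_one_le)
    have tc_T: "t + c j * h \<in> {0..T}" if "j \<le> s" for j
      using tc[OF that] t by auto
    have Z_ball: "Z j \<in> ball (u t) R" if j: "j \<le> s" for j
    proof -
      have sub: "{t..t + c j * h} \<subseteq> {0..T}"
        using tc_T[OF j] t by auto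
      \<comment> \<open>Taylor's formula of order one acts as a mean value bound on the distance
        from u(t).\<close>
      have "norm (D 0 (t + c j * h) - (\<Sum>m<1. ((t + c j * h - t) ^ m / fact m) *\<^sub>R D m t)) \<le> Bu * (t + c j * h - t) ^ 1"
        by (rule Taylor_bound)
          (use tc[OF j] sub D[of 0, THEN has_vector_derivative_within_subset, OF _ _ sub] Bu[of 1] in \<open>auto simp: subset_iff\<close>)
      also have "\<dots> \<le> Bu * h"
        using tc[OF j] \<open>0 \<le> Bu\<close> by (simp add: mult_left_mono)
      also have "\<dots> < R"
        using small[OF h] by blast
      finally show ?thesis
        by (simp add: D0 Z_def dist_norm norm_minus_commute)
    qed
    have Z0: "Z 0 = u t"
      by (simp add: Z_def \<open>c 0 = 0\<close>)
    \<comment> \<open>Only the exact values contribute a residual, and \<open>D12\<close> turns the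
      fields along \<open>u\<close> into derivatives of \<open>u\<close>.\<close>
    have "norm ((Z i - Z 0 - ?\<Psi> h Z i) - (Y h (u t) i - Y h (u t) 0 - ?\<Psi> h (Y h (u t)) i))
        \<le> (1 + (real s + 1) * A) * Bu * h ^ (2 * s + 1)" if i: "i \<in> {1..s}" for i
    proof -
      have "Y h (u t) i - Y h (u t) 0 - ?\<Psi> h (Y h (u t)) i = 0"
        using Y_eq[OF h y i] Y0[OF h y] by (simp add: algebra_simps)
      moreover have "?\<Psi> h Z i = h *\<^sub>R (\<Sum>j=0..s. a i j *\<^sub>R D 1 (t + c j * h))
          + h\<^sup>2 *\<^sub>R (\<Sum>j=0..s. a' i j *\<^sub>R D 2 (t + c j * h))"
        unfolding stage_map_def Z_def using D12 tc_T by simp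
      moreover have "norm (D 0 (t + c i * h) - D 0 t - (h *\<^sub>R (\<Sum>j=0..s. a i j *\<^sub>R D 1 (t + c j * h))
          + h\<^sup>2 *\<^sub>R (\<Sum>j=0..s. a' i j *\<^sub>R D 2 (t + c j * h)))) \<le> (1 + (real s + 1) * A) * Bu * h ^ (2 * s + 1)"
        by (rule hermite_residual_bound[where c = c and T = T])
          (use assms c A[OF i] i D Bu t h in auto)
      ultimately show ?thesis
        by (simp add: Z0) (simp add: Z_def D0)
    qed
    moreover have "Y h (u t) j \<in> ball (u t) R" if "j \<le> s" for j
      using Y_ball[OF h y that] \<open>R > 0\<close> by (simp add: r_def)
    ultimately have "norm (Z s - Y h (u t) s) \<le> (1 + C1 * h) * norm (Z 0 - Y h (u t) 0)
        + 2 * ((1 + (real s + 1) * A) * Bu * h ^ (2 * s + 1))"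
      using u_K[OF t(1)] Z_ball \<open>s \<ge> 1\<close> by (intro stab[OF h]) auto
    moreover have "Z s = u (real (Suc n) * h)"
      by (simp add: Z_def t_def \<open>c s = 1\<close> algebra_simps)
    ultimately show ?thesis
      using Z0 Y0[OF h y] by (simp add: t_def C2_def norm_minus_commute algebra_simps)
  qed
  have global_error: "norm (num_sol s Y h (u 0) n - u (real n * h)) \<le> T * exp (C1 * T) * (C2 * h ^ (2 * s))"
      "norm (num_sol s Y h (u 0) n - u (real n * h)) < r"
    if h: "h \<in> {0<..h0}" and n: "real n * h \<le> T" for h n
  proof -
    define v where "v = num_sol s Y h (u 0)"
    have v_Suc: "v (Suc n) = Y h (v n) s" for n
      by (simp add: v_def num_sol_def)
    \<comment> \<open>The new error splits into the old error propagated by stability and the local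
      error of a step from the exact value \<open>w\<close>. By \<open>close\<close>, both families
      of stages lie in \<open>ball w R\<close>.\<close>
    have step: "norm (v (Suc n) - u (real (Suc n) * h))
        \<le> (1 + C1 * h) * norm (v n - u (real n * h)) + h * (C2 * h ^ (2 * s))"
      if n: "real (Suc n) * h \<le> T" and close: "norm (v n - u (real n * h)) < r" for n
    proof -
      define w where "w = u (real n * h)"
      have w: "w \<in> K"
        using u_K grid prev(1)[OF n h] h by (simp add: w_def)
      have dist: "dist w (v n) < r"
        using close by (simp add: w_def dist_norm norm_minus_commute)
      have wV: "w \<in> V" and vV: "v n \<in> V"
        using w dist \<open>r > 0\<close> by (auto simp: V_def intro: bexI[of _ w])
      have balls: "ball w r \<subseteq> ball w R" "ball (v n) r \<subseteq> ball w R"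
        by (subst ball_subset_ball_iff; use dist \<open>r > 0\<close> in \<open>auto simp: r_def dist_commute\<close>)+
      have "norm (Y h (v n) s - Y h w s) \<le> (1 + C1 * h) * norm (Y h (v n) 0 - Y h w 0) + 2 * 0"
      proof (rule stab[OF h w])
        fix i assume i: "i \<in> {1..s}"
        show "norm ((Y h (v n) i - Y h (v n) 0 - ?\<Psi> h (Y h (v n)) i) - (Y h w i - Y h w 0 - ?\<Psi> h (Y h w) i)) \<le> 0"
          using Y_eq[OF h vV i] Y_eq[OF h wV i] Y0[OF h vV] Y0[OF h wV] by (simp add: algebra_simps)
      next
        show "Y h (v n) j \<in> ball w R" "Y h w j \<in> ball w R" if "j \<le> s" for j
          using Y_ball[OF h vV that] Y_ball[OF h wV that] balls by blast+
      qed (use \<open>s \<ge> 1\<close> in simp)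
      then have "norm (v (Suc n) - Y h w s) \<le> (1 + C1 * h) * norm (v n - w)"
        using Y0[OF h vV] Y0[OF h wV] by (simp add: v_Suc)
      moreover have "norm (Y h w s - u (real (Suc n) * h)) \<le> h * (C2 * h ^ (2 * s))"
        using local_error[OF h n] by (simp add: w_def mult_ac)
      ultimately show ?thesis
        using norm_triangle_ineq[of "v (Suc n) - Y h w s" "Y h w s - u (real (Suc n) * h)"]
        by (simp add: w_def)
    qed
    \<comment> \<open>The last condition on \<open>h0\<close> is linear in \<open>h\<close>; this
      inequality turns it into the smallness condition of the bootstrap.\<close>
    have "h ^ (2 * s) \<le> h"
      using power_decreasing[of 1 "2 * s" h] h small[OF h] \<open>s \<ge> 1\<close> by simp
    then have "T * exp (C1 * T) * C2 * h ^ (2 * s) \<le> T * exp (C1 * T) * C2 * h"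
      using T \<open>0 \<le> C2\<close> by (intro mult_left_mono) auto
    then have le: "T * exp (C1 * T) * (C2 * h ^ (2 * s)) < r"
      using small[OF h] by (simp add: mult.assoc)
    have init: "norm (v 0 - u (real 0 * h)) \<le> 0"
      by (simp add: v_def num_sol_def)
    show "norm (num_sol s Y h (u 0) n - u (real n * h)) \<le> T * exp (C1 * T) * (C2 * h ^ (2 * s))"
      "norm (num_sol s Y h (u 0) n - u (real n * h)) < r"
      using discrete_gronwall[of "\<lambda>n. norm (v n - u (real n * h))" C1 "C2 * h ^ (2 * s)" h T r n]
        init step le n h \<open>0 \<le> C1\<close> \<open>0 \<le> C2\<close> by (auto simp: v_def)
  qed
  show "\<exists>h0 > 0. \<exists>r > 0. \<exists>V Y. open V \<and> u ` {0..T} \<subseteq> V \<and>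
      locally_unique_branch s a a' L U V r h0 Y \<and>
      (\<exists>C. \<forall>h\<in>{0<..h0}. \<forall>n. real (Suc n) * h \<le> T \<longrightarrow>
         norm (Y h (u (real n * h)) s - u (real (Suc n) * h)) \<le> C * h ^ (2 * s + 1)) \<and>
      (\<forall>h\<in>{0<..h0}. \<forall>n. real n * h \<le> T \<longrightarrow> num_sol s Y h (u 0) n \<in> V) \<and>
      (\<exists>C. \<forall>h\<in>{0<..h0}.
         (MAX n\<in>{n. real n \<le> T / h}. norm (num_sol s Y h (u 0) n - u (real n * h))) \<le> C * h ^ (2 * s))"
  proof (rule exI[of _ h0], rule conjI[OF \<open>h0 > 0\<close>], rule exI[of _ r], rule conjI[OF \<open>r > 0\<close>],
      rule exI[of _ V], rule exI[of _ Y], intro conjI)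
    show "open V"
      by (auto simp: V_def)
    show "u ` {0..T} \<subseteq> V"
      using \<open>K \<subseteq> V\<close> by (simp add: K_def)
    show "\<exists>C. \<forall>h\<in>{0<..h0}. \<forall>n. real (Suc n) * h \<le> T \<longrightarrow>
        norm (Y h (u (real n * h)) s - u (real (Suc n) * h)) \<le> C * h ^ (2 * s + 1)"
      using local_error by blast
    show "\<forall>h\<in>{0<..h0}. \<forall>n. real n * h \<le> T \<longrightarrow> num_sol s Y h (u 0) n \<in> V"
    proof (intro ballI allI impI)
      fix h n assume "h \<in> {0<..h0}" "real n * h \<le> T"
      then show "num_sol s Y h (u 0) n \<in> V"
        \<comment> \<open>An error below \<open>r\<close> is membership in \<open>V\<close>, which
          is why the bootstrap also returns the strict bound.\<close>
        using global_error(2) u_K grid unfolding V_def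
        by (intro UN_I[of "u (real n * h)"]) (auto simp: dist_norm norm_minus_commute)
    qed
    show "\<exists>C. \<forall>h\<in>{0<..h0}.
        (MAX n\<in>{n. real n \<le> T / h}. norm (num_sol s Y h (u 0) n - u (real n * h))) \<le> C * h ^ (2 * s)"
    proof (intro exI ballI)
      fix h assume h: "h \<in> {0<..h0}"
      \<comment> \<open>The maximum needs a finite nonempty index set; 0 is always a member.\<close>
      have "{n. real n \<le> T / h} = {..nat \<lfloor>T / h\<rfloor>}"
        using h T by (auto simp: le_nat_iff le_floor_iff)
      then have fin: "finite {n. real n \<le> T / h}"
        by simp
      show "(MAX n\<in>{n. real n \<le> T / h}. norm (num_sol s Y h (u 0) n - u (real n * h)))
          \<le> T * exp (C1 * T) * C2 * h ^ (2 * s)"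
        using fin global_error(1)[OF h] h T
        by (intro Max.boundedI) (auto simp: pos_le_divide_eq mult.assoc intro: exI[of _ 0])
    qed
  qed (rule branch)
qed

end
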